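(* Let $\mathcal{H}$ be a $d$-dimensional complex Hilbert space, let $\mathbb{B}=\{\mathcal{B}_1,\ldots,\mathcal{B}_M\}$ be a set of $M\ge 1$ mutually unbiased bases in $\mathcal{H}$, and let $\rho$ be an arbitrary density matrix on $\mathcal{H}$. Then the min-entropies satisfy the state-dependent bound $$\frac{1}{M}\sum_{\mathcal{B}\in\mathbb{B}}R_\infty(\mathcal{B}|\rho)\;\ge\;\ln d-\ln\!\left(1+M^{-1/2}\sqrt{d-1}\,\sqrt{\mathrm{tr}(\rho^2)\,d-1}\right),$$ and the state-independent bound $$\frac{1}{M}\sum_{\mathcal{B}\in\mathbb{B}}R_\infty(\mathcal{B}|\rho)\;\ge\;\ln\!\left(\frac{\sqrt{M}\,d}{d+\sqrt{M}-1}\right).$$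
   Context: A density matrix on $\mathcal{H}$ is a positive semidefinite operator of trace $1$. Orthonormal bases $\{|b_j\rangle\}$ and $\{|c_k\rangle\}$ of $\mathcal{H}$ are mutually unbiased if $|\langle b_j|c_k\rangle|=1/\sqrt d$ for all $j,k$; a set of bases is a set of mutually unbiased bases (MUBs) if any two different bases in it are mutually unbiased. The min-entropy of a probability distribution $p=\{p_j\}$ is $R_\infty(p)=-\ln(\max_j p_j)$. For an orthonormal basis $\mathcal{B}=\{|b_j\rangle\}_{j=1}^d$, $R_\infty(\mathcal{B}|\rho)$ denotes $R_\infty$ of the distribution $p_j(\mathcal{B}|\rho)=\langle b_j|\rho|b_j\rangle$. *)

theory Defs
  imports Complex_Main "HOL-Library.Nonpos_Ints"
begin

text \<open>
  Complex inner product spaces; the inner product is linear in its second argument and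
  conjugate-linear in its first, so that \<open>cinner x y\<close> is the bracket \<open>\<langle>x|y\<rangle>\<close>.
\<close>

class complex_inner_space = ab_group_add +
  fixes scaleC :: "complex \<Rightarrow> 'a \<Rightarrow> 'a"
    and cinner :: "'a \<Rightarrow> 'a \<Rightarrow> complex"
  assumes scaleC_add_right: "scaleC a (x + y) = scaleC a x + scaleC a y"
    and scaleC_add_left: "scaleC (a + b) x = scaleC a x + scaleC b x"
    and scaleC_scaleC: "scaleC a (scaleC b x) = scaleC (a * b) x"
    and scaleC_one: "scaleC 1 x = x"
    and cinner_commute: "cinner x y = cnj (cinner y x)"
    and cinner_add_right: "cinner x (y + z) = cinner x y + cinner x z"
    and cinner_scaleC_right: "cinner x (scaleC a y) = a * cinner x y"
    and cinner_nonneg: "0 \<le> Re (cinner x x)"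
    and cinner_eq_zero: "cinner x x = 0 \<Longrightarrow> x = 0"

global_interpretation cvec: vector_space "scaleC :: complex \<Rightarrow> 'a \<Rightarrow> 'a::complex_inner_space"
  by unfold_locales
    (simp_all add: scaleC_add_right scaleC_add_left scaleC_scaleC scaleC_one)

text \<open>
  A finite-dimensional complex inner product space is complete, so together with this
  predicate the class describes exactly the finite-dimensional complex Hilbert spaces.
\<close>

definition finite_dimensional :: "'a::complex_inner_space itself \<Rightarrow> bool" where
  "finite_dimensional _ \<longleftrightarrow> (\<exists>B :: 'a set. finite B \<and> cvec.span B = UNIV)"

definition orthonormal_basis :: "'a::complex_inner_space set \<Rightarrow> bool" where
  "orthonormal_basis B \<longleftrightarrow>
     (\<forall>x\<in>B. \<forall>y\<in>B. cinner x y = (if x = y then 1 else 0)) \<and>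
     cvec.independent B \<and> cvec.span B = UNIV"

definition mutually_unbiased ::
  "'a::complex_inner_space set \<Rightarrow> 'a set \<Rightarrow> bool" where
  "mutually_unbiased B C \<longleftrightarrow>
     (\<forall>b\<in>B. \<forall>c\<in>C. cmod (cinner b c) = 1 / sqrt (real (cvec.dim (UNIV :: 'a set))))"

definition is_MUBs :: "'a::complex_inner_space set set \<Rightarrow> bool" where
  "is_MUBs BB \<longleftrightarrow>
     (\<forall>B\<in>BB. orthonormal_basis B) \<and>
     (\<forall>B\<in>BB. \<forall>C\<in>BB. B \<noteq> C \<longrightarrow> mutually_unbiased B C)"

abbreviation operator :: "('a::complex_inner_space \<Rightarrow> 'a) \<Rightarrow> bool" where
  "operator \<equiv> Vector_Spaces.linear scaleC scaleC"

text \<open>In finite dimension the trace does not depend on the chosen orthonormal basis.\<close>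

definition op_trace :: "('a::complex_inner_space \<Rightarrow> 'a) \<Rightarrow> complex" where
  "op_trace A = (\<Sum>b\<in>(SOME B. orthonormal_basis B). cinner b (A b))"

definition positive_semidefinite :: "('a::complex_inner_space \<Rightarrow> 'a) \<Rightarrow> bool" where
  "positive_semidefinite A \<longleftrightarrow> operator A \<and> (\<forall>x. cinner x (A x) \<in> \<real>\<^sub>\<ge>\<^sub>0)"

definition density_operator :: "('a::complex_inner_space \<Rightarrow> 'a) \<Rightarrow> bool" where
  "density_operator \<rho> \<longleftrightarrow> positive_semidefinite \<rho> \<and> op_trace \<rho> = 1"

text \<open>Min-entropy of a probability distribution on a finite nonempty index set \<open>I\<close>.\<close>

definition min_entropy :: "'i set \<Rightarrow> ('i \<Rightarrow> real) \<Rightarrow> real" where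
  "min_entropy I p = - ln (Max (p ` I))"

text \<open>
  The basis vectors themselves index the outcomes. For a density operator
  \<open>\<langle>b|\<rho>|b\<rangle>\<close> is real, so \<open>Re\<close> only changes the type.
\<close>

definition outcome_prob :: "('a::complex_inner_space \<Rightarrow> 'a) \<Rightarrow> 'a \<Rightarrow> real" where
  "outcome_prob \<rho> b = Re (cinner b (\<rho> b))"

definition basis_min_entropy ::
  "'a::complex_inner_space set \<Rightarrow> ('a \<Rightarrow> 'a) \<Rightarrow> real" where
  "basis_min_entropy B \<rho> = min_entropy B (outcome_prob \<rho>)"

end

theory Submission
  imports Defs "HOL-Analysis.L2_Norm"
begin

text \<open>
  For every basis pick the most likely outcome \<open>b\<close> and let \<open>S\<close> be the sum of the \<open>M\<close>
  projections \<open>|b\<rangle>\<langle>b|\<close>. In the Hilbert-Schmidt inner product, unbiasedness gives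
  \<open>\<parallel>S - (M/d) I\<parallel>\<^sup>2 = M (d - 1) / d\<close>, while \<open>\<parallel>\<rho> - I/d\<parallel>\<^sup>2 = tr(\<rho>\<^sup>2) - 1/d\<close>; so Cauchy-Schwarz
  bounds the sum of the maximal probabilities, and concavity of the logarithm turns this into a
  bound on the average min-entropy. The second bound follows from \<open>tr(\<rho>\<^sup>2) \<le> 1\<close>.
\<close>

section \<open>Complex inner product spaces\<close>

lemma cinner_add_left: "cinner (x + y) z = cinner x z + cinner y z"
  by (metis cinner_add_right cinner_commute complex_cnj_add)

lemma cinner_scaleC_left: "cinner (scaleC a x) y = cnj a * cinner x y"
  by (metis cinner_commute cinner_scaleC_right complex_cnj_mult)

lemma cinner_zero_right [simp]: "cinner x 0 = 0"
  using cinner_add_right[of x 0 0] by simp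

lemma cinner_sum_right: "cinner x (\<Sum>i\<in>I. f i) = (\<Sum>i\<in>I. cinner x (f i))"
  by (induction I rule: infinite_finite_induct) (auto simp: cinner_add_right)

lemma orthonormal_basis_finite:
  fixes E :: "'a::complex_inner_space set"
  assumes "finite_dimensional TYPE('a)" "orthonormal_basis E"
  shows "finite E"
proof -
  obtain B :: "'a set" where "finite B" "cvec.span B = UNIV"
    using assms(1) by (auto simp: finite_dimensional_def)
  then show ?thesis
    using cvec.independent_span_bound[of B E] assms(2) by (auto simp: orthonormal_basis_def)
qed

lemma orthonormal_basis_card:
  fixes E :: "'a::complex_inner_space set"
  assumes "orthonormal_basis E"
  shows "card E = cvec.dim (UNIV :: 'a set)"
  using assms cvec.basis_card_eq_dim[of E UNIV] by (simp add: orthonormal_basis_def)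

lemma orthonormal_basis_expansion:
  assumes "orthonormal_basis E" "finite E"
  shows "x = (\<Sum>e\<in>E. scaleC (cinner e x) e)"
proof -
  have on: "cinner e f = (if e = f then 1 else 0)" if "e \<in> E" "f \<in> E" for e f
    using assms(1) that by (simp add: orthonormal_basis_def)
  have "x \<in> cvec.span E"
    using assms(1) by (simp add: orthonormal_basis_def)
  then obtain u where u: "x = (\<Sum>e\<in>E. scaleC (u e) e)"
    using cvec.span_finite[OF assms(2)] by auto
  have "cinner f x = u f" if "f \<in> E" for f
  proof -
    have "cinner f x = (\<Sum>e\<in>E. u e * cinner f e)"
      unfolding u by (simp add: cinner_sum_right cinner_scaleC_right)
    also have "\<dots> = (\<Sum>e\<in>E. if f = e then u e else 0)"
      using on that by (intro sum.cong) auto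
    finally show ?thesis
      using that assms(2) by simp
  qed
  then show ?thesis
    using u by simp
qed

text \<open>Inserts the resolution of the identity over \<open>E\<close>; every later sum over a
  basis is collapsed this way.\<close>

lemma parseval:
  assumes "orthonormal_basis E" "finite E"
  shows "(\<Sum>e\<in>E. cinner x e * cinner e y) = cinner x y"
proof -
  have "cinner x y = cinner x (\<Sum>e\<in>E. scaleC (cinner e y) e)"
    using orthonormal_basis_expansion[OF assms] by simp
  then show ?thesis
    by (simp add: cinner_sum_right cinner_scaleC_right mult.commute)
qed

section \<open>Positive semidefinite operators\<close>

context
  fixes A :: "'a::complex_inner_space \<Rightarrow> 'a"
  assumes psd: "positive_semidefinite A"
begin

lemma psd_add: "A (x + y) = A x + A y"
proof -
  interpret Vector_Spaces.linear scaleC scaleC A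
    using psd by (simp add: positive_semidefinite_def)
  show ?thesis by (rule add)
qed

lemma psd_scaleC: "A (scaleC c x) = scaleC c (A x)"
proof -
  interpret Vector_Spaces.linear scaleC scaleC A
    using psd by (simp add: positive_semidefinite_def)
  show ?thesis by (rule scale)
qed

lemma psd_Re_nonneg: "0 \<le> Re (cinner x (A x))"
  and psd_Im [simp]: "Im (cinner x (A x)) = 0"
  using psd by (auto simp: positive_semidefinite_def complex_nonneg_Reals_iff)

lemma psd_form_expand:
  "cinner (x + scaleC c y) (A (x + scaleC c y)) =
    cinner x (A x) + c * cinner x (A y) + cnj c * cinner y (A x) + cnj c * c * cinner y (A y)"
  by (simp add: psd_add psd_scaleC cinner_add_left cinner_add_right cinner_scaleC_left
      cinner_scaleC_right algebra_simps)

text \<open>Polarization: the quadratic form is real, so the imaginary part of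
  \<open>psd_form_expand\<close> at \<open>c = 1\<close> fixes the imaginary parts and at
  \<open>c = \<i>\<close> the real parts.\<close>

lemma psd_hermitian: "cinner x (A y) = cnj (cinner y (A x))"
proof (rule complex_eqI)
  show "Im (cinner x (A y)) = Im (cnj (cinner y (A x)))"
    using arg_cong[OF psd_form_expand[of x 1 y], of Im] by (simp add: scaleC_one psd_Im)
  show "Re (cinner x (A y)) = Re (cnj (cinner y (A x)))"
    using arg_cong[OF psd_form_expand[of x \<i> y], of Im] by simp
qed

lemma psd_adjoint: "cinner x (A y) = cinner (A x) y"
  by (metis psd_hermitian cinner_commute)

lemma psd_cauchy_schwarz:
  "(cmod (cinner x (A y)))\<^sup>2 \<le> Re (cinner x (A x)) * Re (cinner y (A y))"
proof -
  define z where "z = cinner x (A y)"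
  define a where "a = Re (cinner x (A x))"
  define b where "b = Re (cinner y (A y))"
  have xx: "cinner x (A x) = of_real a" and yy: "cinner y (A y) = of_real b"
    by (simp_all add: a_def b_def complex_eq_iff)
  have yx: "cinner y (A x) = cnj z"
    using psd_hermitian[of y x] by (simp add: z_def)
  \<comment> \<open>The factor \<open>cnj z\<close> cancels the phase of \<open>z\<close>, so both
    cross terms equal \<open>- t * (cmod z)\<^sup>2\<close> and a real quadratic in \<open>t\<close>
    remains.\<close>
  have quad: "0 \<le> a - 2 * t * (cmod z)\<^sup>2 + t\<^sup>2 * (cmod z)\<^sup>2 * b" for t :: real
  proof -
    have "0 \<le> Re (cinner (x + scaleC (- of_real t * cnj z) y)
                   (A (x + scaleC (- of_real t * cnj z) y)))"
      by (rule psd_Re_nonneg)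
    also have "\<dots> = a - 2 * t * (cmod z)\<^sup>2 + t\<^sup>2 * (cmod z)\<^sup>2 * b"
      unfolding psd_form_expand xx yy yx z_def[symmetric] cmod_power2
      by (simp add: algebra_simps power2_eq_square)
    finally show ?thesis .
  qed
  have "(cmod z)\<^sup>2 \<le> a * b"
  proof (cases "b = 0")
    case True
    have "a \<ge> 0" unfolding a_def by (rule psd_Re_nonneg)
    have "(cmod z)\<^sup>2 = 0"
    proof (rule ccontr)
      assume "(cmod z)\<^sup>2 \<noteq> 0"
      then show False
        \<comment> \<open>For \<open>b = 0\<close> the quadratic is linear in \<open>t\<close>; here
          it takes the negative value \<open>- a - 2\<close>.\<close>
        using quad[of "(a + 1) / (cmod z)\<^sup>2"] \<open>a \<ge> 0\<close> True by simp
    qed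
    then show ?thesis using True by simp
  next
    case False
    have "b > 0" using psd_Re_nonneg[of y] False by (simp add: b_def)
    then show ?thesis
      \<comment> \<open>\<open>1 / b\<close> minimizes the quadratic.\<close>
      using quad[of "1 / b"] by (simp add: field_simps power2_eq_square)
  qed
  then show ?thesis
    by (simp add: z_def a_def b_def)
qed

text \<open>Expand each term in the other basis, swap the sums, and collapse the first basis after
  moving \<open>A\<close> across by self-adjointness.\<close>

lemma psd_trace_basis_independent:
  assumes "orthonormal_basis E" "finite E" "orthonormal_basis F" "finite F"
  shows "(\<Sum>e\<in>E. cinner e (A e)) = (\<Sum>f\<in>F. cinner f (A f))"
proof -
  have "(\<Sum>e\<in>E. cinner e (A e)) = (\<Sum>e\<in>E. \<Sum>f\<in>F. cinner e f * cinner f (A e))"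
    by (simp add: parseval assms)
  also have "\<dots> = (\<Sum>f\<in>F. \<Sum>e\<in>E. cinner (A f) e * cinner e f)"
    by (subst sum.swap) (simp add: psd_adjoint mult.commute)
  also have "\<dots> = (\<Sum>f\<in>F. cinner f (A f))"
    by (simp add: parseval assms psd_adjoint)
  finally show ?thesis .
qed

end

section \<open>The Hilbert-Schmidt inner product\<close>

text \<open>The trace of X* Y in matrix entries. Working with plain entry functions lets sums and
  differences be formed without proving them to be operators.\<close>

definition hs :: "'i set \<Rightarrow> ('i \<Rightarrow> 'i \<Rightarrow> complex) \<Rightarrow> ('i \<Rightarrow> 'i \<Rightarrow> complex) \<Rightarrow> complex" where
  "hs E X Y = (\<Sum>e\<in>E. \<Sum>f\<in>E. cnj (X e f) * Y e f)"

lemma hs_commute: "hs E X Y = cnj (hs E Y X)"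
  by (simp add: hs_def mult.commute)

lemma hs_diff_scale_right:
  "hs E X (\<lambda>e f. Y e f - c * Z e f) = hs E X Y - c * hs E X Z"
  by (simp add: hs_def sum_subtractf sum_distrib_left algebra_simps)

lemma hs_diff_scale_left:
  "hs E (\<lambda>e f. Y e f - c * Z e f) X = hs E Y X - cnj c * hs E Z X"
  by (simp add: hs_def sum_subtractf sum_distrib_left algebra_simps)

lemma hs_sum_right: "hs E X (\<lambda>e f. \<Sum>i\<in>I. Y i e f) = (\<Sum>i\<in>I. hs E X (Y i))"
  unfolding hs_def sum_distrib_left
  by (subst sum.swap[of _ I], subst sum.swap[of _ I]) simp

lemma hs_sum_left: "hs E (\<lambda>e f. \<Sum>i\<in>I. Y i e f) X = (\<Sum>i\<in>I. hs E (Y i) X)"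
  by (subst (1 2) hs_commute) (simp add: hs_sum_right)

lemma hs_self: "hs E X X = of_real (\<Sum>e\<in>E. \<Sum>f\<in>E. (cmod (X e f))\<^sup>2)"
  unfolding hs_def of_real_sum
  by (intro sum.cong refl) (metis complex_norm_square mult.commute)

text \<open>Reduces to the real inequality for the moduli of the entries, seen as vectors indexed by
  \<open>E \<times> E\<close>.\<close>

lemma hs_cauchy_schwarz:
  "Re (hs E X Y) \<le> sqrt (Re (hs E X X)) * sqrt (Re (hs E Y Y))"
proof -
  have L2: "L2_set (\<lambda>(e, f). cmod (X e f)) (E \<times> E) = sqrt (Re (hs E X X))" for X
    by (simp add: L2_set_def hs_self sum.cartesian_product case_prod_beta)
  have "Re (hs E X Y) \<le> cmod (hs E X Y)"
    by (rule complex_Re_le_cmod)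
  also have "\<dots> \<le> (\<Sum>(e, f)\<in>E \<times> E. \<bar>cmod (X e f)\<bar> * \<bar>cmod (Y e f)\<bar>)"
    unfolding hs_def sum.cartesian_product
    by (rule order_trans[OF norm_sum]) (simp add: norm_mult case_prod_beta)
  also have "\<dots> \<le> sqrt (Re (hs E X X)) * sqrt (Re (hs E Y Y))"
    using L2_set_mult_ineq[of "\<lambda>(e, f). cmod (X e f)" "\<lambda>(e, f). cmod (Y e f)" "E \<times> E"]
    by (simp add: L2 case_prod_beta)
  finally show ?thesis .
qed

section \<open>Matrices of operators and of rank-one projections\<close>

definition op_matrix :: "('a::complex_inner_space \<Rightarrow> 'a) \<Rightarrow> 'a \<Rightarrow> 'a \<Rightarrow> complex" where
  "op_matrix A e f = cinner e (A f)"

definition proj_matrix :: "'a::complex_inner_space \<Rightarrow> 'a \<Rightarrow> 'a \<Rightarrow> complex" where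
  "proj_matrix b e f = cinner e b * cinner b f"

definition id_matrix :: "'a \<Rightarrow> 'a \<Rightarrow> complex" where
  "id_matrix e f = (if e = f then 1 else 0)"

lemma hs_id_left:
  assumes "finite E"
  shows "hs E id_matrix X = (\<Sum>e\<in>E. X e e)"
proof -
  have "cnj (id_matrix e f) * X e f = (if e = f then X e f else 0)" for e f
    by (simp add: id_matrix_def)
  then show ?thesis
    using assms by (simp add: hs_def)
qed

context
  fixes E :: "'a::complex_inner_space set"
  assumes onb: "orthonormal_basis E" and fin: "finite E"
begin

lemma hs_id_id: "hs E id_matrix id_matrix = of_nat (card E)"
  by (simp add: hs_id_left[OF fin]) (simp add: id_matrix_def)

lemma hs_id_proj: "hs E id_matrix (proj_matrix b) = cinner b b"
  by (simp add: hs_id_left[OF fin] proj_matrix_def mult.commute[of _ "cinner b _"] parseval onb fin)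

text \<open>Arranged so that \<open>parseval\<close> can collapse first the inner sum over
  \<open>e\<close> and then the outer one over \<open>f\<close>.\<close>

lemma hs_proj_left:
  "hs E (proj_matrix b) X = (\<Sum>f\<in>E. (\<Sum>e\<in>E. cinner b e * X e f) * cinner f b)"
  unfolding hs_def sum_distrib_right
  by (subst sum.swap) (simp add: proj_matrix_def cinner_commute[symmetric] algebra_simps)

text \<open>Two uses of \<open>parseval\<close>. This turns unbiasedness, a condition on overlaps,
  into Hilbert-Schmidt products of projections.\<close>

lemma hs_proj_proj: "hs E (proj_matrix b) (proj_matrix c) = of_real ((cmod (cinner b c))\<^sup>2)"
proof -
  have "hs E (proj_matrix b) (proj_matrix c)
      = (\<Sum>f\<in>E. (\<Sum>e\<in>E. cinner b e * cinner e c) * cinner c f * cinner f b)"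
    unfolding hs_proj_left by (simp add: proj_matrix_def sum_distrib_right mult.assoc)
  also have "\<dots> = cinner b c * (\<Sum>f\<in>E. cinner c f * cinner f b)"
    by (simp only: parseval[OF onb fin] sum_distrib_left[symmetric] mult.assoc)
  also have "\<dots> = cinner b c * cnj (cinner b c)"
    by (simp only: parseval[OF onb fin] cinner_commute[of c b])
  finally show ?thesis
    by (simp only: complex_norm_square)
qed

text \<open>Makes an outcome probability a Hilbert-Schmidt product, to which Cauchy-Schwarz
  applies.\<close>

lemma hs_proj_op:
  assumes "positive_semidefinite A"
  shows "hs E (proj_matrix b) (op_matrix A) = cinner b (A b)"
  unfolding hs_proj_left op_matrix_def parseval[OF onb fin]
  unfolding psd_adjoint[OF assms, of b] parseval[OF onb fin] ..

lemma hs_op_op: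
  assumes "positive_semidefinite A"
  shows "hs E (op_matrix A) (op_matrix A) = (\<Sum>e\<in>E. cinner e ((A \<circ> A) e))"
proof -
  have "hs E (op_matrix A) (op_matrix A) = (\<Sum>f\<in>E. \<Sum>e\<in>E. cinner (A f) e * cinner e (A f))"
    unfolding hs_def op_matrix_def cinner_commute[symmetric] by (rule sum.swap)
  then show ?thesis
    unfolding parseval[OF onb fin] by (simp add: psd_adjoint[OF assms])
qed

end

section \<open>Entropy bounds\<close>

text \<open>Jensen's inequality, via the tangent line \<open>ln (p / U) \<le> p / U - 1\<close>.\<close>

lemma average_neg_ln_ge:
  fixes p :: "'i \<Rightarrow> real"
  assumes "finite I" "I \<noteq> {}" "\<And>i. i \<in> I \<Longrightarrow> 0 < p i" "0 < U"
    and "(\<Sum>i\<in>I. p i) \<le> real (card I) * U"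
  shows "- ln U \<le> 1 / real (card I) * (\<Sum>i\<in>I. - ln (p i))"
proof -
  have "(\<Sum>i\<in>I. ln (p i) - ln U) \<le> (\<Sum>i\<in>I. p i / U - 1)"
  proof (rule sum_mono)
    fix i assume "i \<in> I"
    then show "ln (p i) - ln U \<le> p i / U - 1"
      using ln_le_minus_one[of "p i / U"] assms(3,4) by (simp add: ln_divide_pos)
  qed
  also have "\<dots> = (\<Sum>i\<in>I. p i) / U - real (card I)"
    by (simp add: sum_subtractf sum_divide_distrib)
  also have "\<dots> \<le> 0"
    using assms(4,5) by (simp add: field_simps)
  finally have "(\<Sum>i\<in>I. ln (p i)) \<le> real (card I) * ln U"
    by (simp add: sum_subtractf)
  moreover have "0 < real (card I)"
    using assms(1,2) by (simp add: card_gt_0_iff)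
  ultimately show ?thesis
    by (simp add: sum_negf field_simps)
qed

text \<open>The existence of some orthonormal basis makes the \<open>SOME\<close> in
  \<open>op_trace\<close> a genuine one; naming it \<open>E\<close> expresses all traces over one
  basis.\<close>

lemma op_trace_orthonormal_basis:
  fixes \<rho> :: "'a::complex_inner_space \<Rightarrow> 'a"
  assumes "orthonormal_basis (B :: 'a set)"
  obtains E :: "'a set" where "orthonormal_basis E"
    and "\<And>A. op_trace A = (\<Sum>e\<in>E. cinner e (A e))"
  using that[of "SOME B. orthonormal_basis B"] someI[of orthonormal_basis B] assms
  by (simp add: op_trace_def)

section \<open>Density operators: outcome probabilities and purity\<close>

context
  fixes E :: "'a::complex_inner_space set" and \<rho> :: "'a \<Rightarrow> 'a"
  assumes fd: "finite_dimensional TYPE('a)"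
    and onb: "orthonormal_basis E"
    and trE: "\<And>A :: 'a \<Rightarrow> 'a. op_trace A = (\<Sum>e\<in>E. cinner e (A e))"
    and dens: "density_operator \<rho>"
begin

lemma density_psd: "positive_semidefinite \<rho>"
  using dens by (simp add: density_operator_def)

lemma finE: "finite E"
  using orthonormal_basis_finite[OF fd onb] .

lemma density_sum_outcome_prob:
  assumes "orthonormal_basis B"
  shows "(\<Sum>b\<in>B. outcome_prob \<rho> b) = 1"
proof -
  have "(\<Sum>b\<in>B. cinner b (\<rho> b)) = op_trace \<rho>"
    unfolding trE using psd_trace_basis_independent[OF density_psd assms _ onb finE]
    orthonormal_basis_finite[OF fd assms] by simp
  then have "Re (\<Sum>b\<in>B. cinner b (\<rho> b)) = 1"
    using dens by (simp add: density_operator_def)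
  then show ?thesis
    by (simp add: outcome_prob_def)
qed

text \<open>In dimension zero the outcome probabilities would form an empty sum, which is not
  1.\<close>

lemma dim_pos: "0 < card E"
proof (rule ccontr)
  assume "\<not> 0 < card E"
  then have "E = {}" using finE by auto
  then show False using density_sum_outcome_prob[OF onb] by simp
qed

text \<open>The purity is the sum of the squared moduli of the entries of \<rho>. Each is at most
  the product of two diagonal entries, and these products sum to the squared trace.\<close>

lemma purity_le_1: "Re (op_trace (\<rho> \<circ> \<rho>)) \<le> 1"
proof -
  have "Re (op_trace (\<rho> \<circ> \<rho>)) = (\<Sum>e\<in>E. \<Sum>f\<in>E. (cmod (cinner e (\<rho> f)))\<^sup>2)"
    unfolding trE hs_op_op[OF onb finE density_psd, symmetric] hs_self
    by (simp add: op_matrix_def)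
  also have "\<dots> \<le> (\<Sum>e\<in>E. \<Sum>f\<in>E. outcome_prob \<rho> e * outcome_prob \<rho> f)"
    unfolding outcome_prob_def by (intro sum_mono psd_cauchy_schwarz density_psd)
  also have "\<dots> = (\<Sum>e\<in>E. outcome_prob \<rho> e) * (\<Sum>f\<in>E. outcome_prob \<rho> f)"
    by (simp add: sum_product)
  finally show ?thesis
    by (simp add: density_sum_outcome_prob onb)
qed

lemma density_max_attained:
  assumes "orthonormal_basis B"
  obtains b where "b \<in> B" "Max (outcome_prob \<rho> ` B) = outcome_prob \<rho> b" "0 < outcome_prob \<rho> b"
proof -
  have fB: "finite B" using orthonormal_basis_finite[OF fd assms] .
  have "B \<noteq> {}" using density_sum_outcome_prob[OF assms] by auto
  then have "Max (outcome_prob \<rho> ` B) \<in> outcome_prob \<rho> ` B"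
    using fB by (intro Max_in) auto
  then obtain b where b: "b \<in> B" "Max (outcome_prob \<rho> ` B) = outcome_prob \<rho> b"
    by auto
  have "0 < outcome_prob \<rho> b"
  proof (rule ccontr)
    assume "\<not> 0 < outcome_prob \<rho> b"
    \<comment> \<open>A nonpositive maximum would keep the probabilities from summing to 1.\<close>
    then have "outcome_prob \<rho> c \<le> 0" if "c \<in> B" for c
      using Max_ge[of "outcome_prob \<rho> ` B" "outcome_prob \<rho> c"] fB b that by fastforce
    then have "(\<Sum>c\<in>B. outcome_prob \<rho> c) \<le> 0"
      by (rule sum_nonpos)
    then show False using density_sum_outcome_prob[OF assms] by simp
  qed
  then show ?thesis using that b by blast
qed

lemma hs_id_density: "hs E id_matrix (op_matrix \<rho>) = 1"
  using dens by (simp add: hs_id_left[OF finE] op_matrix_def density_operator_def trE)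

text \<open>Subtracting \<open>1 / d\<close> times the identity makes \<rho> traceless, that is,
  orthogonal to the identity.\<close>

lemma density_centered_norm:
  defines "d \<equiv> real (card E)"
  shows "Re (hs E (\<lambda>e f. op_matrix \<rho> e f - of_real (1 / d) * id_matrix e f)
                  (\<lambda>e f. op_matrix \<rho> e f - of_real (1 / d) * id_matrix e f))
      = (Re (op_trace (\<rho> \<circ> \<rho>)) * d - 1) / d"
proof -
  have dp: "d > 0" using dim_pos by (simp add: d_def)
  have RI: "hs E (op_matrix \<rho>) id_matrix = 1"
    by (subst hs_commute) (simp add: hs_id_density)
  have II: "hs E id_matrix id_matrix = d"
    by (simp add: hs_id_id[OF onb finE] d_def)
  have RR: "hs E (op_matrix \<rho>) (op_matrix \<rho>) = op_trace (\<rho> \<circ> \<rho>)"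
    unfolding trE by (rule hs_op_op[OF onb finE density_psd])
  show ?thesis
    unfolding hs_diff_scale_right hs_diff_scale_left hs_id_density RI II RR
    using dp by (simp add: field_simps)
qed

section \<open>Unit vectors with pairwise unbiased overlaps\<close>

context
  fixes I :: "'i set" and b :: "'i \<Rightarrow> 'a"
  assumes finI: "finite I"
    and unit: "\<And>i. i \<in> I \<Longrightarrow> cinner (b i) (b i) = 1"
    and unbiased: "\<And>i j. \<lbrakk>i \<in> I; j \<in> I; i \<noteq> j\<rbrakk> \<Longrightarrow>
      cmod (cinner (b i) (b j)) = 1 / sqrt (real (card E))"
begin

lemma hs_id_projections:
  "hs E id_matrix (\<lambda>e f. \<Sum>i\<in>I. proj_matrix (b i) e f) = real (card I)"
  by (simp add: hs_sum_right hs_id_proj[OF onb finE] unit)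

text \<open>The sum of projections has trace \<open>M\<close>, so \<open>M / d\<close> removes its
  identity component. The \<open>M\<close> equal pairs contribute 1 each and the others
  \<open>1 / d\<close>; centering subtracts \<open>M * M / d\<close>.\<close>

lemma projections_centered_norm:
  defines "d \<equiv> real (card E)" and "M \<equiv> real (card I)"
  shows "Re (hs E (\<lambda>e f. (\<Sum>i\<in>I. proj_matrix (b i) e f) - of_real (M / d) * id_matrix e f)
                  (\<lambda>e f. (\<Sum>i\<in>I. proj_matrix (b i) e f) - of_real (M / d) * id_matrix e f))
      = M * (d - 1) / d" (is "Re (hs E ?Q ?Q) = _")
proof -
  have dp: "d > 0" using dim_pos by (simp add: d_def)
  let ?S = "\<lambda>e f. \<Sum>i\<in>I. proj_matrix (b i) e f"
  have SI: "hs E ?S id_matrix = M"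
    by (subst hs_commute) (simp add: hs_id_projections M_def)
  have II: "hs E id_matrix id_matrix = d"
    by (simp add: hs_id_id[OF onb finE] d_def)
  \<comment> \<open>A constant plus a diagonal correction, so that the double sum splits.\<close>
  have pair: "(cmod (cinner (b i) (b j)))\<^sup>2 = 1 / d + (if i = j then 1 - 1 / d else 0)"
    if "i \<in> I" "j \<in> I" for i j
    using unit[OF that(1)] unbiased[OF that] dp by (auto simp: d_def power_divide)
  have "hs E ?S ?S = of_real (\<Sum>j\<in>I. \<Sum>i\<in>I. (cmod (cinner (b i) (b j)))\<^sup>2)"
    by (simp add: hs_sum_right hs_sum_left hs_proj_proj[OF onb finE])
  also have "(\<Sum>j\<in>I. \<Sum>i\<in>I. (cmod (cinner (b i) (b j)))\<^sup>2)
      = (\<Sum>j\<in>I. \<Sum>i\<in>I. 1 / d + (if i = j then 1 - 1 / d else 0))"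
    by (intro sum.cong refl pair)
  also have "\<dots> = M * M / d + M * (1 - 1 / d)"
    using finI by (simp add: sum.distrib M_def algebra_simps)
  finally have SS: "hs E ?S ?S = of_real (M * M / d + M * (1 - 1 / d))" .
  show ?thesis
    unfolding hs_diff_scale_right hs_diff_scale_left hs_id_projections M_def[symmetric] SI II SS
    using dp by (simp add: field_simps)
qed

lemma sum_outcome_prob_unbiased_le:
  defines "d \<equiv> real (card E)" and "M \<equiv> real (card I)"
  shows "(\<Sum>i\<in>I. outcome_prob \<rho> (b i))
      \<le> (M + sqrt M * sqrt (d - 1) * sqrt (Re (op_trace (\<rho> \<circ> \<rho>)) * d - 1)) / d"
proof -
  have dp: "d > 0" using dim_pos by (simp add: d_def)
  let ?S = "\<lambda>e f. \<Sum>i\<in>I. proj_matrix (b i) e f"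
  let ?Q = "\<lambda>e f. ?S e f - of_real (M / d) * id_matrix e f"
  let ?R = "\<lambda>e f. op_matrix \<rho> e f - of_real (1 / d) * id_matrix e f"
  have II: "hs E id_matrix id_matrix = d"
    by (simp add: hs_id_id[OF onb finE] d_def)
  have SI: "hs E ?S id_matrix = M"
    by (subst hs_commute) (simp add: hs_id_projections M_def)
  have SR: "hs E ?S (op_matrix \<rho>) = (\<Sum>i\<in>I. cinner (b i) (\<rho> (b i)))"
    by (simp add: hs_sum_left hs_proj_op[OF onb finE density_psd])
  \<comment> \<open>The two cross terms and the identity term combine to a single
    \<open>- M / d\<close>.\<close>
  have "Re (hs E ?Q ?R) = (\<Sum>i\<in>I. outcome_prob \<rho> (b i)) - M / d"
    unfolding hs_diff_scale_right hs_diff_scale_left hs_id_density II SI SR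
    using dp by (simp add: outcome_prob_def field_simps)
  moreover have "Re (hs E ?Q ?R) \<le> sqrt (Re (hs E ?Q ?Q)) * sqrt (Re (hs E ?R ?R))"
    by (rule hs_cauchy_schwarz)
  ultimately have "(\<Sum>i\<in>I. outcome_prob \<rho> (b i)) - M / d
      \<le> sqrt (M * (d - 1) / d) * sqrt ((Re (op_trace (\<rho> \<circ> \<rho>)) * d - 1) / d)"
    unfolding density_centered_norm[folded d_def] projections_centered_norm[folded d_def M_def]
    by simp
  also have "\<dots> = sqrt M * sqrt (d - 1) * sqrt (Re (op_trace (\<rho> \<circ> \<rho>)) * d - 1) / d"
    using dp by (simp add: real_sqrt_mult real_sqrt_divide)
  finally show ?thesis
    unfolding add_divide_distrib by linarith
qed

end

text \<open>Up to the factor \<open>card E\<close> this is the squared norm in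
  \<open>density_centered_norm\<close>.\<close>

lemma purity_ge: "0 \<le> Re (op_trace (\<rho> \<circ> \<rho>)) * real (card E) - 1"
proof -
  have "0 \<le> (Re (op_trace (\<rho> \<circ> \<rho>)) * real (card E) - 1) / real (card E)"
    unfolding density_centered_norm[symmetric] hs_self by (simp add: sum_nonneg)
  then show ?thesis
    using dim_pos by (simp add: zero_le_divide_iff)
qed

end

section \<open>The two entropy bounds\<close>

theorem proposition3:
  fixes BB :: "'a::complex_inner_space set set"
    and \<rho> :: "'a \<Rightarrow> 'a"
    and d M :: nat
  assumes "finite_dimensional TYPE('a)"
    and "cvec.dim (UNIV :: 'a set) = d"
    and "is_MUBs BB"
    and "finite BB" and "card BB = M" and "M \<ge> 1"
    and "density_operator \<rho>"
  shows "1 / real M * (\<Sum>B\<in>BB. basis_min_entropy B \<rho>)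
           \<ge> ln (real d) - ln (1 + real M powr (- 1 / 2) * sqrt (real d - 1)
                                   * sqrt (Re (op_trace (\<rho> \<circ> \<rho>)) * real d - 1))
       \<and> 1 / real M * (\<Sum>B\<in>BB. basis_min_entropy B \<rho>)
           \<ge> ln (sqrt (real M) * real d / (real d + sqrt (real M) - 1))"
proof -
  have onbs: "orthonormal_basis B" if "B \<in> BB" for B
    using assms(3) that by (simp add: is_MUBs_def)
  have "BB \<noteq> {}" using assms(5,6) by auto
  then obtain B0 where "B0 \<in> BB" by auto
  then obtain E :: "'a set" where E: "orthonormal_basis E"
    and trE: "\<And>A :: 'a \<Rightarrow> 'a. op_trace A = (\<Sum>e\<in>E. cinner e (A e))"
    using op_trace_orthonormal_basis onbs by metis
  note ctx = assms(1) E trE assms(7)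
  have cardE: "card E = d"
    using orthonormal_basis_card[OF E] assms(2) by simp
  have d1: "real d \<ge> 1"
    using dim_pos[OF ctx] cardE by simp
  have M1: "real M \<ge> 1" using assms(6) by simp
  define P where "P = Re (op_trace (\<rho> \<circ> \<rho>))"
  have P: "P \<le> 1" "0 \<le> P * real d - 1"
    using purity_le_1[OF ctx] purity_ge[OF ctx] by (simp_all add: P_def cardE)
  \<comment> \<open>One most likely outcome per basis; the bases themselves index this
    family.\<close>
  have "\<forall>B\<in>BB. \<exists>b\<in>B. Max (outcome_prob \<rho> ` B) = outcome_prob \<rho> b \<and> 0 < outcome_prob \<rho> b"
    using density_max_attained[OF ctx onbs] by metis
  then obtain b where b: "\<And>B. B \<in> BB \<Longrightarrow> b B \<in> B"
    "\<And>B. B \<in> BB \<Longrightarrow> Max (outcome_prob \<rho> ` B) = outcome_prob \<rho> (b B)"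
    "\<And>B. B \<in> BB \<Longrightarrow> 0 < outcome_prob \<rho> (b B)"
    by metis
  have unit: "cinner (b B) (b B) = 1" if "B \<in> BB" for B
    using onbs[OF that] b(1)[OF that] by (simp add: orthonormal_basis_def)
  have unb: "cmod (cinner (b B) (b C)) = 1 / sqrt (real (card E))"
    if "B \<in> BB" "C \<in> BB" "B \<noteq> C" for B C
    using assms(3) that b(1) by (simp add: is_MUBs_def mutually_unbiased_def assms(2) cardE)
  have le: "(\<Sum>B\<in>BB. outcome_prob \<rho> (b B))
      \<le> (real M + sqrt (real M) * sqrt (real d - 1) * sqrt (P * real d - 1)) / real d"
    using sum_outcome_prob_unbiased_le[OF ctx assms(4) unit unb]
    by (simp add: cardE assms(5) P_def)
  \<comment> \<open>Both bounds are instances of this, for two choices of \<open>U\<close> above the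
    average maximal probability.\<close>
  have avg: "- ln U \<le> 1 / real M * (\<Sum>B\<in>BB. basis_min_entropy B \<rho>)"
    if "0 < U" "(real M + sqrt (real M) * sqrt (real d - 1) * sqrt (P * real d - 1)) / real d
      \<le> real M * U" for U
  proof -
    have "(\<Sum>B\<in>BB. outcome_prob \<rho> (b B)) \<le> real M * U"
      using le that(2) by linarith
    then have "- ln U \<le> 1 / real M * (\<Sum>B\<in>BB. - ln (outcome_prob \<rho> (b B)))"
      using average_neg_ln_ge[of BB "\<lambda>B. outcome_prob \<rho> (b B)" U]
        assms(4,5) \<open>BB \<noteq> {}\<close> b(3) that(1) by simp
    then show ?thesis
      by (simp add: basis_min_entropy_def min_entropy_def b(2))
  qed
  define m where "m = sqrt (real M)"
  have m: "m > 0" "real M = m * m"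
    using M1 by (simp_all add: m_def)
  have pw: "real M powr (- 1 / 2) = 1 / m"
    using M1 by (simp add: m_def powr_minus powr_half_sqrt[symmetric] inverse_eq_divide)
  define s where "s = sqrt (real d - 1) * sqrt (P * real d - 1)"
  have s0: "0 \<le> s"
    using d1 P by (simp add: s_def)
  \<comment> \<open>Since \<open>P \<le> 1\<close>, both factors of \<open>s\<close> are at most
    \<open>sqrt (real d - 1)\<close>.\<close>
  have s_le: "s \<le> real d - 1"
  proof -
    have "P * real d - 1 \<le> real d - 1"
      using P d1 by (simp add: mult_left_le_one_le)
    then have "s \<le> sqrt (real d - 1) * sqrt (real d - 1)"
      unfolding s_def using d1 by (intro mult_left_mono) auto
    then show ?thesis using d1 by simp
  qed
  \<comment> \<open>This \<open>U\<close> is exactly the Cauchy-Schwarz bound divided by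
    \<open>M\<close>.\<close>
  have "- ln ((1 + 1 / m * s) / real d) \<le> 1 / real M * (\<Sum>B\<in>BB. basis_min_entropy B \<rho>)"
  proof (rule avg)
    show "0 < (1 + 1 / m * s) / real d"
      using d1 m s0 by (simp add: add_pos_nonneg)
    show "(real M + sqrt (real M) * sqrt (real d - 1) * sqrt (P * real d - 1)) / real d
      \<le> real M * ((1 + 1 / m * s) / real d)"
      unfolding m_def[symmetric] mult.assoc s_def[symmetric] m(2)
      using m(1) d1 by (simp add: field_simps)
  qed
  moreover have "- ln ((1 + 1 / m * s) / real d) = ln (real d) - ln (1 + 1 / m * s)"
    using d1 m s0 by (subst ln_divide_pos) (auto intro: add_pos_nonneg)
  \<comment> \<open>The previous \<open>U\<close> with \<open>s\<close> replaced by its upper bound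
    \<open>real d - 1\<close>, which removes the dependence on \<rho>.\<close>
  moreover have "- ln ((real d + m - 1) / (m * real d))
      \<le> 1 / real M * (\<Sum>B\<in>BB. basis_min_entropy B \<rho>)"
  proof (rule avg)
    show "0 < (real d + m - 1) / (m * real d)"
      using d1 m by (intro divide_pos_pos mult_pos_pos) auto
    have "(m * m + m * s) / real d \<le> (m * m + m * (real d - 1)) / real d"
      using s_le m(1) by (simp add: divide_right_mono)
    also have "\<dots> = m * m * ((real d + m - 1) / (m * real d))"
      using m(1) d1 by (simp add: field_simps)
    finally show "(real M + sqrt (real M) * sqrt (real d - 1) * sqrt (P * real d - 1)) / real d
      \<le> real M * ((real d + m - 1) / (m * real d))"
      unfolding mult.assoc s_def[symmetric] m_def[symmetric] m(2)[symmetric]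
      unfolding m(2) mult.assoc .
  qed
  moreover have "- ln ((real d + m - 1) / (m * real d)) = ln (m * real d / (real d + m - 1))"
    using ln_inverse[of "(real d + m - 1) / (m * real d)"] d1 m by simp
  ultimately show ?thesis
    unfolding pw P_def[symmetric] m_def[symmetric] by (simp add: s_def mult.assoc)
qed

end
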